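(* The elliptic Artin group $\mathrm{Art}(\tilde{D}_4^{(1,1)})$ is isomorphic to the group $G'(\tilde{D}_4^{(1,1)})$ defined by the presentation with generators $t_i$ ($i\in\mathbb{Z}$), $s_1,s_2,s_3,s_4$ and relations: (R1) $t_is_jt_i=s_jt_is_j$ for $i\in\mathbb{Z}$ and $j=1,2,3,4$; (R2) $s_is_j=s_js_i$ for $i\neq j$ in $\{1,2,3,4\}$; (R3) $t_it_{i-1}=t_jt_{j-1}$ for $i,j\in\mathbb{Z}$. Moreover, adding to this presentation the quadratic relations $t_i^2=1$ ($i\in\mathbb{Z}$) and $s_j^2=1$ ($j=1,2,3,4$) gives a presentation of the group $\mathrm{Hyp}(\tilde{D}_4^{(1,1)})$.
   Context: The elliptic Artin group $\mathrm{Art}(\tilde{D}_4^{(1,1)})$ is taken to be the group $G(\tilde{D}_4^{(1,1)})$ given by the (usual, known) presentation with generators $t_0,t_1,s_1,s_2,s_3,s_4$ and relations: (P1) $t_is_jt_i=s_jt_is_j$ for $i=0,1$ and $j=1,2,3,4$; (P2) $s_is_j=s_js_i$ for $i\neq j$ in $\{1,2,3,4\}$; (P3) $s_it_1t_0s_it_1t_0=t_1t_0s_it_1t_0s_i$ for $i=1,2,3,4$. The hyperbolic elliptic Weyl group $\mathrm{Hyp}(\tilde{D}_4^{(1,1)})$ is the group presented by these generators and relations (P1)-(P3) together with $t_i^2=1$ for $i=0,1$ and $s_j^2=1$ for $j=1,2,3,4$. *)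

theory Defs
  imports "HOL-Algebra.Group"
begin

section \<open>Groups given by generators and relations\<close>

text \<open>
  The letter \<open>(x, True)\<close> stands for the generator \<open>x\<close> and \<open>(x, False)\<close> for its formal inverse.
  A relation is a pair of words \<open>(u, v)\<close>, read as \<open>u = v\<close>.
\<close>

type_synonym 'a word = "('a \<times> bool) list"

definition words :: "'a set \<Rightarrow> 'a word set" where
  "words X = lists (X \<times> UNIV)"

text \<open>
  The least congruence on the words over \<open>X\<close> that makes formal inverses inverse and satisfies the
  relations in \<open>R\<close>, i.e. equality in the free group on \<open>X\<close> modulo the normal closure of the
  elements \<open>u v\<^sup>-\<^sup>1\<close> with \<open>(u, v) \<in> R\<close>. Pairs in \<open>R\<close> that are not words over \<open>X\<close> are ignored.
\<close>

inductive pres_eq :: "'a set \<Rightarrow> ('a word \<times> 'a word) set \<Rightarrow> 'a word \<Rightarrow> 'a word \<Rightarrow> bool"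
  for X :: "'a set" and R :: "('a word \<times> 'a word) set" where
  refl: "u \<in> words X \<Longrightarrow> pres_eq X R u u"
| sym: "pres_eq X R u v \<Longrightarrow> pres_eq X R v u"
| trans: "pres_eq X R u v \<Longrightarrow> pres_eq X R v w \<Longrightarrow> pres_eq X R u w"
| cong: "pres_eq X R u u' \<Longrightarrow> pres_eq X R v v' \<Longrightarrow> pres_eq X R (u @ v) (u' @ v')"
| cancel: "x \<in> X \<Longrightarrow> pres_eq X R [(x, b), (x, \<not> b)] []"
| rel: "(u, v) \<in> R \<Longrightarrow> u \<in> words X \<Longrightarrow> v \<in> words X \<Longrightarrow> pres_eq X R u v"

definition pres_rel :: "'a set \<Rightarrow> ('a word \<times> 'a word) set \<Rightarrow> ('a word \<times> 'a word) set" where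
  "pres_rel X R = {(u, v). pres_eq X R u v}"

definition presented_group :: "'a set \<Rightarrow> ('a word \<times> 'a word) set \<Rightarrow> 'a word set monoid" where
  "presented_group X R =
    \<lparr>carrier = words X // pres_rel X R,
     mult = (\<lambda>A B. \<Union>u\<in>A. \<Union>v\<in>B. pres_rel X R `` {u @ v}),
     one = pres_rel X R `` {[]}\<rparr>"

lemma pres_eq_words: "pres_eq X R u v \<Longrightarrow> u \<in> words X \<and> v \<in> words X"
  by (induction rule: pres_eq.induct) (auto simp: words_def)

lemma equiv_pres_rel: "equiv (words X) (pres_rel X R)"
proof (rule equivI)
  show "pres_rel X R \<subseteq> words X \<times> words X"
    by (auto simp: pres_rel_def dest: pres_eq_words)
  show "refl_on (words X) (pres_rel X R)"
    by (auto simp: refl_on_def pres_rel_def intro: pres_eq.refl)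
  show "sym (pres_rel X R)"
    by (auto simp: sym_def pres_rel_def intro: pres_eq.sym)
  show "trans (pres_rel X R)"
    by (auto simp: trans_def pres_rel_def intro: pres_eq.trans)
qed

lemma presented_group_mult:
  assumes "u \<in> words X" "v \<in> words X"
  shows "pres_rel X R `` {u} \<otimes>\<^bsub>presented_group X R\<^esub> pres_rel X R `` {v} = pres_rel X R `` {u @ v}"
proof -
  have "congruent2 (pres_rel X R) (pres_rel X R) (\<lambda>u v. pres_rel X R `` {u @ v})"
    by (rule congruent2I') (rule equiv_class_eq[OF equiv_pres_rel],
      auto simp: pres_rel_def intro: pres_eq.cong)
  from UN_equiv_class2[OF equiv_pres_rel equiv_pres_rel this assms]
  show ?thesis by (simp add: presented_group_def)
qed

lemma words_append: "u \<in> words X \<Longrightarrow> v \<in> words X \<Longrightarrow> u @ v \<in> words X"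
  by (auto simp: words_def)

lemma words_left_inverse: "u \<in> words X \<Longrightarrow> \<exists>v\<in>words X. pres_eq X R (v @ u) []"
proof (induction u)
  case Nil
  then show ?case by (auto simp: words_def intro!: bexI[of _ "[]"] pres_eq.refl)
next
  case (Cons a u)
  obtain x b where a: "a = (x, b)" by force
  from Cons.prems have x: "x \<in> X" and u: "u \<in> words X" by (auto simp: words_def a)
  from Cons.IH[OF u] obtain v where v: "v \<in> words X" "pres_eq X R (v @ u) []" by auto
  have c: "pres_eq X R [(x, \<not> b), (x, b)] []"
    using pres_eq.cancel[OF x, of R "\<not> b"] by simp
  have "pres_eq X R (v @ [(x, \<not> b), (x, b)] @ u) (v @ [] @ u)"
    by (intro pres_eq.cong pres_eq.refl c v u)
  then have "pres_eq X R ((v @ [(x, \<not> b)]) @ a # u) []"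
    using v(2) by (auto simp: a intro: pres_eq.trans)
  moreover have "v @ [(x, \<not> b)] \<in> words X" using v x by (auto simp: words_def)
  ultimately show ?case by blast
qed

lemma group_presented_group: "group (presented_group X R)"
proof -
  let ?G = "presented_group X R"
  have car: "carrier ?G = words X // pres_rel X R" by (simp add: presented_group_def)
  have one: "\<one>\<^bsub>?G\<^esub> = pres_rel X R `` {[]}" by (simp add: presented_group_def)
  have nil: "[] \<in> words X" by (simp add: words_def)
  show ?thesis
  proof (rule groupI)
    fix A B assume "A \<in> carrier ?G" "B \<in> carrier ?G"
    then show "A \<otimes>\<^bsub>?G\<^esub> B \<in> carrier ?G"
      unfolding car by (auto elim!: quotientE simp: presented_group_mult words_append intro!: quotientI)
  next
    show "\<one>\<^bsub>?G\<^esub> \<in> carrier ?G" unfolding one car by (rule quotientI[OF nil])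
  next
    fix A B C assume "A \<in> carrier ?G" "B \<in> carrier ?G" "C \<in> carrier ?G"
    then show "A \<otimes>\<^bsub>?G\<^esub> B \<otimes>\<^bsub>?G\<^esub> C = A \<otimes>\<^bsub>?G\<^esub> (B \<otimes>\<^bsub>?G\<^esub> C)"
      unfolding car by (auto elim!: quotientE simp: presented_group_mult words_append)
  next
    fix A assume "A \<in> carrier ?G"
    then show "\<one>\<^bsub>?G\<^esub> \<otimes>\<^bsub>?G\<^esub> A = A"
      unfolding car one by (auto elim!: quotientE simp: presented_group_mult nil)
  next
    fix A assume "A \<in> carrier ?G"
    then obtain u where u: "u \<in> words X" "A = pres_rel X R `` {u}"
      unfolding car by (auto elim!: quotientE)
    obtain v where v: "v \<in> words X" "pres_eq X R (v @ u) []"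
      using words_left_inverse[OF u(1)] by blast
    have "pres_rel X R `` {v} \<otimes>\<^bsub>?G\<^esub> A = \<one>\<^bsub>?G\<^esub>"
      using v u equiv_class_eq[OF equiv_pres_rel, of "v @ u" "[]" X R]
      by (simp add: presented_group_mult one) (simp add: pres_rel_def)
    moreover have "pres_rel X R `` {v} \<in> carrier ?G" unfolding car by (rule quotientI[OF v(1)])
    ultimately show "\<exists>B\<in>carrier ?G. B \<otimes>\<^bsub>?G\<^esub> A = \<one>\<^bsub>?G\<^esub>" by blast
  qed
qed


section \<open>The presentations attached to the elliptic diagram of type $\tilde{D}_4^{(1,1)}$\<close>

datatype gen = T int | S nat

abbreviation tg :: "int \<Rightarrow> gen word" where "tg i \<equiv> [(T i, True)]"
abbreviation sg :: "nat \<Rightarrow> gen word" where "sg j \<equiv> [(S j, True)]"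

text \<open>
  The parameter \<open>I\<close> is the index set of the generators \<open>t\<^sub>i\<close>: it is \<open>{0, 1}\<close> for the usual
  presentation and all of \<open>\<int>\<close> for the infinite one.
\<close>

definition gens :: "int set \<Rightarrow> gen set" where
  "gens I = T ` I \<union> S ` {1..4}"

definition braid_rels :: "int set \<Rightarrow> (gen word \<times> gen word) set" where
  "braid_rels I = {(tg i @ sg j @ tg i, sg j @ tg i @ sg j) | i j. i \<in> I \<and> j \<in> {1..4}}"

definition comm_rels :: "(gen word \<times> gen word) set" where
  "comm_rels = {(sg i @ sg j, sg j @ sg i) | i j. i \<in> {1..4} \<and> j \<in> {1..4} \<and> i \<noteq> j}"

definition elliptic_rels :: "(gen word \<times> gen word) set" where
  "elliptic_rels =
    {(sg i @ tg 1 @ tg 0 @ sg i @ tg 1 @ tg 0, tg 1 @ tg 0 @ sg i @ tg 1 @ tg 0 @ sg i) | i. i \<in> {1..4}}"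

definition shift_rels :: "(gen word \<times> gen word) set" where
  "shift_rels = {(tg i @ tg (i - 1), tg j @ tg (j - 1)) | i j. True}"

definition quadratic_rels :: "int set \<Rightarrow> (gen word \<times> gen word) set" where
  "quadratic_rels I = {(tg i @ tg i, []) | i. i \<in> I} \<union> {(sg j @ sg j, []) | j. j \<in> {1..4}}"

definition Art_D4_rels :: "(gen word \<times> gen word) set" where
  "Art_D4_rels = braid_rels {0, 1} \<union> comm_rels \<union> elliptic_rels"

definition Art_D4 :: "gen word set monoid" where
  "Art_D4 = presented_group (gens {0, 1}) Art_D4_rels"

definition Hyp_D4 :: "gen word set monoid" where
  "Hyp_D4 = presented_group (gens {0, 1}) (Art_D4_rels \<union> quadratic_rels {0, 1})"

definition G'_D4_rels :: "(gen word \<times> gen word) set" where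
  "G'_D4_rels = braid_rels UNIV \<union> comm_rels \<union> shift_rels"

definition G'_D4 :: "gen word set monoid" where
  "G'_D4 = presented_group (gens UNIV) G'_D4_rels"

end

theory Submission
  imports Defs
begin

text \<open>
  Put \<open>c = t\<^sub>1 t\<^sub>0\<close>. The shift relations say \<open>t\<^sub>i t\<^sub>i\<^sub>-\<^sub>1 = c\<close> for all \<open>i\<close>, so they determine every \<open>t\<^sub>i\<close>
  from \<open>t\<^sub>0\<close> and \<open>t\<^sub>1\<close>, namely \<open>t\<^sub>2\<^sub>k = c\<^sup>k t\<^sub>0 c\<^sup>-\<^sup>k\<close> and \<open>t\<^sub>2\<^sub>k\<^sub>+\<^sub>1 = c\<^sup>k t\<^sub>1 c\<^sup>-\<^sup>k\<close>. If \<open>a\<close>, \<open>b\<close>, \<open>x\<close> are three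
  consecutive \<open>t\<^sub>i\<close> and \<open>a\<close>, \<open>b\<close> satisfy the braid relation with \<open>s\<close>, then
  \<open>s c s c = (s x s) (b s a)\<close> and \<open>c s c s = (x s x) (b s a)\<close>, so the braid relation between \<open>x\<close> and \<open>s\<close>
  is equivalent to \<open>s c s c = c s c s\<close>. Together with the mirror image of this observation, induction
  in both directions gives the braid relations for all \<open>i \<in> \<int>\<close>. Hence a family satisfying the finite
  presentation extends uniquely to one satisfying the infinite presentation.
\<close>

section \<open>Models of a presentation\<close>

definition word_eval :: "('g, 'm) monoid_scheme \<Rightarrow> ('a \<Rightarrow> 'g) \<Rightarrow> 'a word \<Rightarrow> 'g" where
  "word_eval G f w = foldr (\<lambda>(x, b) a. (if b then f x else inv\<^bsub>G\<^esub> f x) \<otimes>\<^bsub>G\<^esub> a) w \<one>\<^bsub>G\<^esub>"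

lemma word_eval_simps [simp]:
  "word_eval G f [] = \<one>\<^bsub>G\<^esub>"
  "word_eval G f ((x, b) # w) = (if b then f x else inv\<^bsub>G\<^esub> f x) \<otimes>\<^bsub>G\<^esub> word_eval G f w"
  by (simp_all add: word_eval_def)

text \<open>All pairs in \<open>R\<close> must hold here, whereas \<open>pres_eq\<close> ignores
  pairs that are not words over \<open>X\<close>; this is why
  \<open>R \<subseteq> words X \<times> words X\<close> is assumed further on.\<close>

definition pres_model ::
    "'a set \<Rightarrow> ('a word \<times> 'a word) set \<Rightarrow> ('g, 'm) monoid_scheme \<Rightarrow> ('a \<Rightarrow> 'g) \<Rightarrow> bool" where
  "pres_model X R G f \<longleftrightarrow>
    group G \<and> f \<in> X \<rightarrow> carrier G \<and> (\<forall>(u, v)\<in>R. word_eval G f u = word_eval G f v)"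

definition pres_gen :: "'a set \<Rightarrow> ('a word \<times> 'a word) set \<Rightarrow> 'a \<Rightarrow> 'a word set" where
  "pres_gen X R x = pres_rel X R `` {[(x, True)]}"

lemma pres_model_Un:
  "pres_model X (R \<union> Q) G f \<longleftrightarrow> pres_model X R G f \<and> pres_model X Q G f"
  by (auto simp: pres_model_def)

lemma pres_model_mono:
  "pres_model Y Q G f \<Longrightarrow> X \<subseteq> Y \<Longrightarrow> R \<subseteq> Q \<Longrightarrow> pres_model X R G f"
  unfolding pres_model_def by blast

lemma Nil_words [simp]: "[] \<in> words X"
  by (simp add: words_def)

lemma Cons_words [simp]: "(x, b) # w \<in> words X \<longleftrightarrow> x \<in> X \<and> w \<in> words X"
  by (simp add: words_def)

lemma word_eval_closed:
  assumes "group G" "f \<in> X \<rightarrow> carrier G" "w \<in> words X"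
  shows "word_eval G f w \<in> carrier G"
proof -
  interpret group G by fact
  show ?thesis using assms(3)
  proof (induction w)
    case (Cons a w)
    then show ?case using assms(2) by (cases a) (auto simp: Pi_iff)
  qed simp
qed

lemma word_eval_append:
  assumes "group G" "f \<in> X \<rightarrow> carrier G" "u \<in> words X" "v \<in> words X"
  shows "word_eval G f (u @ v) = word_eval G f u \<otimes>\<^bsub>G\<^esub> word_eval G f v"
proof -
  interpret group G by fact
  note closed = word_eval_closed[OF assms(1,2)]
  show ?thesis using assms(3)
  proof (induction u)
    case Nil
    then show ?case using closed[OF assms(4)] by simp
  next
    case (Cons a u)
    then show ?case using assms(2) closed[OF assms(4)] closed[of u]
      by (cases a) (auto simp: Pi_iff m_assoc)
  qed
qed

lemma word_eval_hom:
  assumes "group G" "group H" "F \<in> hom G H" "f \<in> X \<rightarrow> carrier G" "w \<in> words X"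
  shows "F (word_eval G f w) = word_eval H (F \<circ> f) w"
proof -
  interpret group_hom G H F
    using assms(1-3) by (simp add: group_hom_def group_hom_axioms_def)
  show ?thesis using assms(5)
  proof (induction w)
    case (Cons a w)
    then show ?case using assms(4) word_eval_closed[OF assms(1,4), of w]
      by (cases a) (auto simp: Pi_iff)
  qed simp
qed

lemma pres_model_cong:
  assumes "R \<subseteq> words X \<times> words X" "\<And>x. x \<in> X \<Longrightarrow> f x = g x"
  shows "pres_model X R G f \<longleftrightarrow> pres_model X R G g"
proof -
  have "word_eval G f w = word_eval G g w" if "w \<in> words X" for w
    using that by (induction w) (auto simp: assms(2))
  then show ?thesis
    using assms by (auto simp: pres_model_def Pi_iff subset_iff)
qed

text \<open>Each closure rule of \<open>pres_eq\<close> is valid in a group whose elements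
  \<open>f x\<close> satisfy \<open>R\<close>. This soundness makes evaluation well defined on
  classes.\<close>

lemma pres_eq_word_eval:
  assumes "pres_model X R G f" "pres_eq X R u v"
  shows "word_eval G f u = word_eval G f v"
proof -
  have G: "group G" and f: "f \<in> X \<rightarrow> carrier G"
    and rel: "\<And>u v. (u, v) \<in> R \<Longrightarrow> word_eval G f u = word_eval G f v"
    using assms(1) by (auto simp: pres_model_def)
  interpret group G by (rule G)
  show ?thesis using assms(2)
  proof induction
    case (cong u u' v v')
    then show ?case by (auto dest!: pres_eq_words simp: word_eval_append[OF G f])
  next
    case (cancel x b)
    then show ?case using f by (auto simp: Pi_iff)
  qed (auto simp: rel)
qed

section \<open>Universal property of a presented group\<close>

lemma carrier_presented_groupE:
  assumes "A \<in> carrier (presented_group X R)"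
  obtains w where "w \<in> words X" "A = pres_rel X R `` {w}"
  using assms by (auto simp: presented_group_def elim!: quotientE)

lemma pres_class_closed:
  "w \<in> words X \<Longrightarrow> pres_rel X R `` {w} \<in> carrier (presented_group X R)"
  by (simp add: presented_group_def quotientI)

lemma pres_rel_iff: "(u, v) \<in> pres_rel X R \<longleftrightarrow> pres_eq X R u v"
  by (simp add: pres_rel_def)

lemma pres_class_eq: "pres_eq X R u v \<Longrightarrow> pres_rel X R `` {u} = pres_rel X R `` {v}"
  by (rule equiv_class_eq[OF equiv_pres_rel]) (simp add: pres_rel_iff)

lemma pres_gen_closed: "pres_gen X R \<in> X \<rightarrow> carrier (presented_group X R)"
  by (simp add: pres_gen_def pres_class_closed)

lemma word_eval_pres_gen:
  assumes "w \<in> words X"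
  shows "word_eval (presented_group X R) (pres_gen X R) w = pres_rel X R `` {w}"
  using assms
proof (induction w)
  case Nil
  then show ?case by (simp add: presented_group_def)
next
  case (Cons a w)
  let ?P = "presented_group X R"
  interpret P: group ?P by (rule group_presented_group)
  obtain x b where a: "a = (x, b)" by force
  with Cons.prems have x: "x \<in> X" and w: "w \<in> words X" by auto
  \<comment> \<open>The rule \<open>cancel\<close> makes the formal inverse represent the group
    inverse.\<close>
  have "inv\<^bsub>?P\<^esub> pres_gen X R x = pres_rel X R `` {[(x, False)]}"
  proof (rule P.inv_equality)
    show "pres_rel X R `` {[(x, False)]} \<otimes>\<^bsub>?P\<^esub> pres_gen X R x = \<one>\<^bsub>?P\<^esub>"
      using pres_class_eq[OF pres_eq.cancel[OF x, of R False]] x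
      by (simp add: pres_gen_def presented_group_mult) (simp add: presented_group_def)
  qed (use x in \<open>auto simp: pres_gen_def intro: pres_class_closed\<close>)
  then have "(if b then pres_gen X R x else inv\<^bsub>?P\<^esub> pres_gen X R x) = pres_rel X R `` {[(x, b)]}"
    by (simp add: pres_gen_def)
  then show ?case
    using Cons.IH[OF w] x w presented_group_mult[of "[(x, b)]" X w R] by (simp add: a)
qed

lemma pres_model_pres_gen:
  assumes "R \<subseteq> words X \<times> words X"
  shows "pres_model X R (presented_group X R) (pres_gen X R)"
proof -
  have "word_eval (presented_group X R) (pres_gen X R) u =
      word_eval (presented_group X R) (pres_gen X R) v" if "(u, v) \<in> R" for u v
    using that assms pres_class_eq[OF pres_eq.rel[of u v R X]]
    by (auto simp: word_eval_pres_gen)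
  then show ?thesis
    using group_presented_group[of X R] pres_gen_closed[of X R] by (auto simp: pres_model_def)
qed

text \<open>Von Dyck's theorem, the existence half of the universal property.\<close>

lemma pres_model_hom:
  assumes "pres_model X R G f"
  obtains F where "F \<in> hom (presented_group X R) G" "\<And>x. x \<in> X \<Longrightarrow> F (pres_gen X R x) = f x"
proof
  have G: "group G" and f: "f \<in> X \<rightarrow> carrier G"
    using assms by (auto simp: pres_model_def)
  interpret group G by (rule G)
  \<comment> \<open>Evaluation at an arbitrary representative; by soundness the choice does not
    affect the value.\<close>
  define F where "F A = word_eval G f (SOME w. w \<in> A)" for A
  have F: "F (pres_rel X R `` {w}) = word_eval G f w" if "w \<in> words X" for w
  proof -
    have "w \<in> pres_rel X R `` {w}" using that by (simp add: pres_rel_iff pres_eq.refl)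
    then have "(SOME u. u \<in> pres_rel X R `` {w}) \<in> pres_rel X R `` {w}" by (rule someI)
    then have "pres_eq X R w (SOME u. u \<in> pres_rel X R `` {w})"
      by (simp only: Image_singleton_iff pres_rel_iff)
    from pres_eq_word_eval[OF assms this] show ?thesis by (simp add: F_def)
  qed
  show "F \<in> hom (presented_group X R) G"
    by (auto simp: hom_def F presented_group_mult words_append word_eval_append[OF G f]
        word_eval_closed[OF G f] elim!: carrier_presented_groupE)
  show "F (pres_gen X R x) = f x" if "x \<in> X" for x
    using that f F[of "[(x, True)]"] by (auto simp: pres_gen_def Pi_iff)
qed

text \<open>The uniqueness half, for endomorphisms: every element is the value of a word at the
  generators, and evaluation commutes with homomorphisms.\<close>

lemma presented_group_hom_id:
  assumes "F \<in> hom (presented_group X R) (presented_group X R)"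
    and "\<And>x. x \<in> X \<Longrightarrow> F (pres_gen X R x) = pres_gen X R x"
    and "A \<in> carrier (presented_group X R)"
  shows "F A = A"
proof -
  let ?P = "presented_group X R"
  obtain w where w: "w \<in> words X" "A = word_eval ?P (pres_gen X R) w"
    using assms(3) by (auto simp: word_eval_pres_gen elim: carrier_presented_groupE)
  have "word_eval ?P (F \<circ> pres_gen X R) w = word_eval ?P (pres_gen X R) w"
    using w(1)
  proof (induction w)
    case (Cons a w)
    then show ?case by (cases a) (auto simp: assms(2))
  qed simp
  with w show ?thesis
    by (simp add: word_eval_hom[OF group_presented_group group_presented_group assms(1)
          pres_gen_closed])
qed

lemma pres_model_hom_image:
  assumes "pres_model X R G f" "group H" "F \<in> hom G H" "R \<subseteq> words X \<times> words X"
  shows "pres_model X R H (F \<circ> f)"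
  using assms
  by (auto simp: pres_model_def Pi_iff hom_def subset_iff
      simp flip: word_eval_hom[OF _ assms(2,3), of f X] split: prod.splits)

text \<open>If models of the larger presentation restrict to models of the smaller one, and each
  model of the latter extends uniquely, then both groups have the same universal property. Models in
  \<open>'a word set monoid\<close> suffice, because the only groups tested are the two presented
  groups.\<close>

lemma presented_group_iso:
  fixes X Y :: "'a set"
  assumes "X \<subseteq> Y" and R: "R \<subseteq> words X \<times> words X" and Q: "Q \<subseteq> words Y \<times> words Y"
    and restrict: "\<And>(G :: 'a word set monoid) f. pres_model Y Q G f \<Longrightarrow> pres_model X R G f"
    and extend: "\<And>(G :: 'a word set monoid) f.
      pres_model X R G f \<Longrightarrow> \<exists>g. pres_model Y Q G g \<and> (\<forall>x\<in>X. g x = f x)"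
    and unique: "\<And>(G :: 'a word set monoid) f g y.
      pres_model Y Q G f \<Longrightarrow> pres_model Y Q G g \<Longrightarrow> (\<And>x. x \<in> X \<Longrightarrow> f x = g x) \<Longrightarrow> y \<in> Y \<Longrightarrow> f y = g y"
  shows "presented_group X R \<cong> presented_group Y Q"
proof -
  let ?G = "presented_group X R" and ?H = "presented_group Y Q"
  have genH: "pres_model Y Q ?H (pres_gen Y Q)" by (rule pres_model_pres_gen[OF Q])
  obtain F where F: "F \<in> hom ?G ?H" "\<And>x. x \<in> X \<Longrightarrow> F (pres_gen X R x) = pres_gen Y Q x"
    using pres_model_hom[OF restrict[OF genH]] by blast
  obtain k where k: "pres_model Y Q ?G k" "\<And>x. x \<in> X \<Longrightarrow> k x = pres_gen X R x"
    using extend[OF pres_model_pres_gen[OF R]] by blast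
  obtain K where K: "K \<in> hom ?H ?G" "\<And>y. y \<in> Y \<Longrightarrow> K (pres_gen Y Q y) = k y"
    using pres_model_hom[OF k(1)] by blast
  \<comment> \<open>\<open>F \<circ> k\<close> and the generators are two models in
    \<open>?H\<close> that agree on \<open>X\<close>, so uniqueness makes them agree on
    \<open>Y\<close>.\<close>
  have Fk: "F (k y) = pres_gen Y Q y" if "y \<in> Y" for y
    using unique[OF pres_model_hom_image[OF k(1) group_presented_group F(1) Q] genH, of y] that
    by (simp add: k F)
  have KF: "K (F A) = A" if "A \<in> carrier ?G" for A
    using presented_group_hom_id[OF hom_compose[OF F(1) K(1)] _ that] \<open>X \<subseteq> Y\<close>
    by (auto simp: F K k subset_iff)
  have FK: "F (K B) = B" if "B \<in> carrier ?H" for B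
    using presented_group_hom_id[OF hom_compose[OF K(1) F(1)] _ that] by (auto simp: K Fk)
  have "bij_betw F (carrier ?G) (carrier ?H)"
    by (rule bij_betw_byWitness[where f' = K]) (use KF FK F(1) K(1) in \<open>auto simp: hom_def\<close>)
  with F(1) show ?thesis by (auto simp: is_iso_def iso_def)
qed

section \<open>Sequences with constant consecutive products\<close>

context group
begin

section \<open>Braid relations of three neighbouring terms\<close>

text \<open>The common right factor \<open>b \<otimes> s \<otimes> a\<close> cancels, which gives an
  equivalence. One direction yields (P3) from the braid relation of the next term, the other is the
  upward induction step.\<close>

lemma braid_next_iff:
  assumes [simp]: "a \<in> carrier G" "b \<in> carrier G" "x \<in> carrier G" "s \<in> carrier G"
    and x: "x \<otimes> b = b \<otimes> a"
    and a: "a \<otimes> s \<otimes> a = s \<otimes> a \<otimes> s" and b: "b \<otimes> s \<otimes> b = s \<otimes> b \<otimes> s"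
  defines "c \<equiv> b \<otimes> a"
  shows "x \<otimes> s \<otimes> x = s \<otimes> x \<otimes> s \<longleftrightarrow> s \<otimes> c \<otimes> s \<otimes> c = c \<otimes> s \<otimes> c \<otimes> s"
proof -
  \<comment> \<open>Writing the first \<open>c\<close> as \<open>x \<otimes> b\<close> and the
    second as \<open>b \<otimes> a\<close> creates the factor
    \<open>b \<otimes> s \<otimes> b\<close>.\<close>
  have "s \<otimes> c \<otimes> s \<otimes> c = s \<otimes> (x \<otimes> b) \<otimes> s \<otimes> (b \<otimes> a)" by (simp add: c_def x)
  also have "\<dots> = s \<otimes> x \<otimes> (b \<otimes> s \<otimes> b) \<otimes> a" by (simp add: m_assoc)
  also have "\<dots> = (s \<otimes> x \<otimes> s) \<otimes> (b \<otimes> s \<otimes> a)" by (simp add: b m_assoc)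
  finally have 1: "s \<otimes> c \<otimes> s \<otimes> c = (s \<otimes> x \<otimes> s) \<otimes> (b \<otimes> s \<otimes> a)" .
  have "c \<otimes> s \<otimes> c \<otimes> s = (x \<otimes> b) \<otimes> s \<otimes> (b \<otimes> a) \<otimes> s" by (simp add: c_def x)
  also have "\<dots> = x \<otimes> (b \<otimes> s \<otimes> b) \<otimes> a \<otimes> s" by (simp add: m_assoc)
  also have "\<dots> = x \<otimes> s \<otimes> b \<otimes> (s \<otimes> a \<otimes> s)" by (simp add: b m_assoc)
  also have "\<dots> = x \<otimes> s \<otimes> (b \<otimes> a) \<otimes> s \<otimes> a" by (simp add: a[symmetric] m_assoc)
  also have "\<dots> = (x \<otimes> s \<otimes> x) \<otimes> (b \<otimes> s \<otimes> a)" by (simp add: x[symmetric] m_assoc)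
  finally have 2: "c \<otimes> s \<otimes> c \<otimes> s = (x \<otimes> s \<otimes> x) \<otimes> (b \<otimes> s \<otimes> a)" .
  show ?thesis unfolding 1 2 by auto
qed

text \<open>Mirror image for the downward induction step: with the second \<open>c\<close> written
  as \<open>a \<otimes> y\<close>, the factor \<open>b \<otimes> s \<otimes> a\<close> appears on
  the left and cancels.\<close>

lemma braid_prev_iff:
  assumes [simp]: "a \<in> carrier G" "b \<in> carrier G" "y \<in> carrier G" "s \<in> carrier G"
    and y: "a \<otimes> y = b \<otimes> a"
    and a: "a \<otimes> s \<otimes> a = s \<otimes> a \<otimes> s" and b: "b \<otimes> s \<otimes> b = s \<otimes> b \<otimes> s"
  defines "c \<equiv> b \<otimes> a"
  shows "y \<otimes> s \<otimes> y = s \<otimes> y \<otimes> s \<longleftrightarrow> s \<otimes> c \<otimes> s \<otimes> c = c \<otimes> s \<otimes> c \<otimes> s"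
proof -
  have "s \<otimes> c \<otimes> s \<otimes> c = s \<otimes> (b \<otimes> a) \<otimes> s \<otimes> (a \<otimes> y)" by (simp add: c_def y)
  also have "\<dots> = s \<otimes> b \<otimes> (a \<otimes> s \<otimes> a) \<otimes> y" by (simp add: m_assoc)
  also have "\<dots> = (s \<otimes> b \<otimes> s) \<otimes> a \<otimes> s \<otimes> y" by (simp add: a m_assoc)
  also have "\<dots> = b \<otimes> s \<otimes> (b \<otimes> a) \<otimes> s \<otimes> y" by (simp add: b[symmetric] m_assoc)
  also have "\<dots> = (b \<otimes> s \<otimes> a) \<otimes> (y \<otimes> s \<otimes> y)" by (simp add: y[symmetric] m_assoc)
  finally have 1: "s \<otimes> c \<otimes> s \<otimes> c = (b \<otimes> s \<otimes> a) \<otimes> (y \<otimes> s \<otimes> y)" .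
  have "c \<otimes> s \<otimes> c \<otimes> s = (b \<otimes> a) \<otimes> s \<otimes> (a \<otimes> y) \<otimes> s" by (simp add: c_def y)
  also have "\<dots> = b \<otimes> (a \<otimes> s \<otimes> a) \<otimes> y \<otimes> s" by (simp add: m_assoc)
  also have "\<dots> = (b \<otimes> s \<otimes> a) \<otimes> (s \<otimes> y \<otimes> s)" by (simp add: a m_assoc)
  finally have 2: "c \<otimes> s \<otimes> c \<otimes> s = (b \<otimes> s \<otimes> a) \<otimes> (s \<otimes> y \<otimes> s)" .
  show ?thesis unfolding 1 2 by auto
qed

section \<open>Existence, uniqueness and properties of the infinite sequence\<close>

lemma shift_seq_exists:
  assumes [simp]: "a \<in> carrier G" "b \<in> carrier G"
  obtains t :: "int \<Rightarrow> 'a" where "\<And>i. t i \<in> carrier G" "t 0 = a" "t 1 = b"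
    "\<And>i. t i \<otimes> t (i - 1) = b \<otimes> a"
proof
  define c where "c = b \<otimes> a"
  have c [simp]: "c \<in> carrier G" by (simp add: c_def)
  define t where
    \<comment> \<open>\<open>div\<close> rounds down, so the formula also fits negative odd indices:
      \<open>t (- 1)\<close> is \<open>b\<close> conjugated by the inverse of
      \<open>c\<close>.\<close>
    "t i = c [^] (i div 2) \<otimes> (if even i then a else b) \<otimes> inv (c [^] (i div 2))" for i :: int
  show "t i \<in> carrier G" for i by (simp add: t_def)
  show "t 0 = a" "t 1 = b" by (simp_all add: t_def)
  show "t i \<otimes> t (i - 1) = b \<otimes> a" for i
  proof (cases "even i")
    case True
    then obtain k where i: "i = 2 * k" by (elim evenE)
    \<comment> \<open>The predecessor is \<open>2 * (k - 1) + 1\<close>, so its exponent is one less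
      than that of \<open>2 * k\<close>; the leftover \<open>inv c\<close> cancels between
      \<open>a\<close> and \<open>b\<close>.\<close>
    define d where "d = c [^] (k - 1)"
    have d [simp]: "d \<in> carrier G" by (simp add: d_def)
    have ck: "c [^] k = d \<otimes> c"
      using int_pow_mult[OF c, of "k - 1" 1] by (simp add: d_def)
    have "(2 * k - 1) div 2 = k - 1" by presburger
    then have "t i \<otimes> t (i - 1) = d \<otimes> c \<otimes> a \<otimes> inv (d \<otimes> c) \<otimes> (d \<otimes> b \<otimes> inv d)"
      by (simp add: i t_def ck flip: d_def)
    also have "\<dots> = d \<otimes> c \<otimes> (a \<otimes> inv c \<otimes> b) \<otimes> inv d"
      by (simp add: inv_mult_group m_assoc flip: m_assoc[of "inv d" d])
    also have "a \<otimes> inv c \<otimes> b = \<one>"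
      by (simp add: c_def inv_mult_group m_assoc flip: m_assoc[of a "inv a"])
    also have "d \<otimes> c \<otimes> \<one> \<otimes> inv d = c"
      using int_pow_mult[OF c, of 1 "k - 1"] ck
      by (simp add: d_def m_assoc add.commute)
    finally show ?thesis by (simp add: c_def)
  next
    case False
    then obtain k where i: "i = 2 * k + 1" by (elim oddE)
    define d where "d = c [^] k"
    have d [simp]: "d \<in> carrier G" by (simp add: d_def)
    have dc: "d \<otimes> c = c \<otimes> d"
      using int_pow_mult[OF c, of 1 k] int_pow_mult[OF c, of k 1]
      by (simp add: d_def add.commute)
    have "t i \<otimes> t (i - 1) = d \<otimes> b \<otimes> inv d \<otimes> (d \<otimes> a \<otimes> inv d)"
      by (simp add: i t_def flip: d_def)
    also have "\<dots> = d \<otimes> c \<otimes> inv d"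
      by (simp add: c_def m_assoc flip: m_assoc[of "inv d" d])
    also have "\<dots> = c" by (simp add: dc m_assoc)
    finally show ?thesis by (simp add: c_def)
  qed
qed

text \<open>Each product determines either factor from the other by cancellation, so agreement at
  index 0 spreads in both directions.\<close>

lemma shift_seq_unique:
  fixes t u :: "int \<Rightarrow> 'a"
  assumes [simp]: "\<And>i. t i \<in> carrier G" "\<And>i. u i \<in> carrier G" and "t 0 = u 0"
    and eq: "\<And>i. t i \<otimes> t (i - 1) = u i \<otimes> u (i - 1)"
  shows "t i = u i"
proof (induction i rule: int_induct[where k = 0])
  case (step1 i)
  then show ?case using eq[of "i + 1"] by simp
next
  case (step2 i)
  then show ?case using eq[of i] by simp
qed fact

lemma shift_seq_braid:
  fixes t :: "int \<Rightarrow> 'a"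
  assumes [simp]: "\<And>i. t i \<in> carrier G" "s \<in> carrier G"
    and c: "\<And>i. t i \<otimes> t (i - 1) = c"
    and t0: "t 0 \<otimes> s \<otimes> t 0 = s \<otimes> t 0 \<otimes> s" and t1: "t 1 \<otimes> s \<otimes> t 1 = s \<otimes> t 1 \<otimes> s"
    and P3: "s \<otimes> c \<otimes> s \<otimes> c = c \<otimes> s \<otimes> c \<otimes> s"
  shows "t i \<otimes> s \<otimes> t i = s \<otimes> t i \<otimes> s"
proof -
  \<comment> \<open>Two neighbouring braid relations are needed to get a third, so the induction
    carries a pair.\<close>
  have "t i \<otimes> s \<otimes> t i = s \<otimes> t i \<otimes> s \<and> t (i + 1) \<otimes> s \<otimes> t (i + 1) = s \<otimes> t (i + 1) \<otimes> s"
  proof (induction i rule: int_induct[where k = 0])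
    case base
    then show ?case by (simp add: t0 t1)
  next
    case (step1 i)
    then show ?case
      using braid_next_iff[of "t i" "t (i + 1)" "t (i + 1 + 1)" s] c[of "i + 1"] c[of "i + 1 + 1"] P3
      by (simp add: add.commute)
  next
    case (step2 i)
    then show ?case
      using braid_prev_iff[of "t i" "t (i + 1)" "t (i - 1)" s] c[of "i + 1"] c[of i] P3
      by simp
  qed
  then show ?thesis by simp
qed

text \<open>Since \<open>t (i + 1) \<otimes> t i = t i \<otimes> t (i - 1)\<close>, the terms at
  distance two are conjugate by \<open>t i\<close>, and so are their squares. Both parities have to
  be started, at 0 and at 1.\<close>

lemma shift_seq_involution:
  fixes t :: "int \<Rightarrow> 'a"
  assumes [simp]: "\<And>i. t i \<in> carrier G"
    and c: "\<And>i. t i \<otimes> t (i - 1) = c"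
    and t0: "t 0 \<otimes> t 0 = \<one>" and t1: "t 1 \<otimes> t 1 = \<one>"
  shows "t i \<otimes> t i = \<one>"
proof -
  have conj: "t (i + 1) \<otimes> t (i + 1) \<otimes> t i = t i \<otimes> (t (i - 1) \<otimes> t (i - 1))" for i
  proof -
    have "t (i + 1) \<otimes> t i = t i \<otimes> t (i - 1)" using c[of "i + 1"] c[of i] by simp
    then show ?thesis by (simp add: m_assoc flip: m_assoc[of "t (i + 1)" "t i" "t (i - 1)"])
  qed
  have "t i \<otimes> t i = \<one> \<and> t (i + 1) \<otimes> t (i + 1) = \<one>"
  proof (induction i rule: int_induct[where k = 0])
    case base
    then show ?case by (simp add: t0 t1)
  next
    case (step1 i)
    then show ?case using conj[of "i + 1"] by simp
  next
    case (step2 i)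
    then show ?case using conj[of i] by simp
  qed
  then show ?thesis by simp
qed

end

section \<open>The two presentations\<close>

lemma ball_rels:
  "(\<forall>(u, v)\<in>{(p i, q i) |i. P i}. E u v) \<longleftrightarrow> (\<forall>i. P i \<longrightarrow> E (p i) (q i))"
  "(\<forall>(u, v)\<in>{(p' i j, q' i j) |i j. P' i j}. E u v) \<longleftrightarrow>
    (\<forall>i j. P' i j \<longrightarrow> E (p' i j) (q' i j))"
  by blast+

lemma gens_funcset:
  "f \<in> gens I \<rightarrow> M \<longleftrightarrow> (\<forall>i\<in>I. f (T i) \<in> M) \<and> (\<forall>j\<in>{1..4}. f (S j) \<in> M)"
  by (auto simp: gens_def Pi_iff)

lemma gens_mono: "I \<subseteq> J \<Longrightarrow> gens I \<subseteq> gens J"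
  by (auto simp: gens_def)

lemma quadratic_rels_mono: "I \<subseteq> J \<Longrightarrow> quadratic_rels I \<subseteq> quadratic_rels J"
  by (auto simp: quadratic_rels_def)

lemma rels_words:
  "Art_D4_rels \<subseteq> words (gens {0, 1}) \<times> words (gens {0, 1})"
  "G'_D4_rels \<subseteq> words (gens UNIV) \<times> words (gens UNIV)"
  "quadratic_rels I \<subseteq> words (gens I) \<times> words (gens I)"
  by (auto simp: Art_D4_rels_def G'_D4_rels_def braid_rels_def comm_rels_def elliptic_rels_def
      shift_rels_def quadratic_rels_def gens_def)

text \<open>What both presentations share: the commuting elements \<open>s j\<close>. Interpreting
  it also opens the group context.\<close>

locale D4_family = group G for G (structure) +
  fixes s :: "nat \<Rightarrow> 'a"
  assumes s_closed [simp]: "\<And>j. j \<in> {1..4} \<Longrightarrow> s j \<in> carrier G"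
    and s_comm: "\<And>i j. i \<in> {1..4} \<Longrightarrow> j \<in> {1..4} \<Longrightarrow> i \<noteq> j \<Longrightarrow> s i \<otimes> s j = s j \<otimes> s i"

lemma pres_model_Art_D4_iff:
  fixes G (structure)
  shows "pres_model (gens {0, 1}) Art_D4_rels G f \<longleftrightarrow>
    D4_family G (f \<circ> S) \<and> f (T 0) \<in> carrier G \<and> f (T 1) \<in> carrier G \<and>
    (\<forall>j\<in>{1..4}. f (T 0) \<otimes> f (S j) \<otimes> f (T 0) = f (S j) \<otimes> f (T 0) \<otimes> f (S j)) \<and>
    (\<forall>j\<in>{1..4}. f (T 1) \<otimes> f (S j) \<otimes> f (T 1) = f (S j) \<otimes> f (T 1) \<otimes> f (S j)) \<and>
    (\<forall>j\<in>{1..4}. f (S j) \<otimes> (f (T 1) \<otimes> f (T 0)) \<otimes> f (S j) \<otimes> (f (T 1) \<otimes> f (T 0)) =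
      f (T 1) \<otimes> f (T 0) \<otimes> f (S j) \<otimes> (f (T 1) \<otimes> f (T 0)) \<otimes> f (S j))"
\<comment> \<open>Each side forces this condition; the case split supplies the closure facts that
  reassociating the words requires.\<close>
proof (cases "group G \<and> f \<in> gens {0, 1} \<rightarrow> carrier G")
  case True
  then interpret group G by simp
  have [simp]: "\<And>i. i \<in> {0, 1} \<Longrightarrow> f (T i) \<in> carrier G" "\<And>j. j \<in> {1..4} \<Longrightarrow> f (S j) \<in> carrier G"
    using True by (auto simp: gens_funcset)
  show ?thesis
    unfolding pres_model_def D4_family_def D4_family_axioms_def Art_D4_rels_def ball_Un
      braid_rels_def comm_rels_def elliptic_rels_def ball_rels
    using True by (auto simp: m_assoc)
next
  case False
  then show ?thesis
    by (auto simp: pres_model_def gens_funcset D4_family_def D4_family_axioms_def)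
qed

lemma pres_model_G'_D4_iff:
  fixes G (structure)
  shows "pres_model (gens UNIV) G'_D4_rels G f \<longleftrightarrow>
    D4_family G (f \<circ> S) \<and> (\<forall>i. f (T i) \<in> carrier G) \<and>
    (\<forall>i. \<forall>j\<in>{1..4}. f (T i) \<otimes> f (S j) \<otimes> f (T i) = f (S j) \<otimes> f (T i) \<otimes> f (S j)) \<and>
    (\<forall>i j. f (T i) \<otimes> f (T (i - 1)) = f (T j) \<otimes> f (T (j - 1)))"
proof (cases "group G \<and> f \<in> gens UNIV \<rightarrow> carrier G")
  case True
  then interpret group G by simp
  have [simp]: "\<And>i. f (T i) \<in> carrier G" "\<And>j. j \<in> {1..4} \<Longrightarrow> f (S j) \<in> carrier G"
    using True by (auto simp: gens_funcset)
  show ?thesis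
    unfolding pres_model_def D4_family_def D4_family_axioms_def G'_D4_rels_def ball_Un
      braid_rels_def comm_rels_def shift_rels_def ball_rels
    using True by (auto simp: m_assoc)
next
  case False
  then show ?thesis
    by (auto simp: pres_model_def gens_funcset D4_family_def D4_family_axioms_def)
qed

lemma pres_model_quadratic_iff:
  fixes G (structure)
  assumes "group G" "f \<in> gens I \<rightarrow> carrier G"
  shows "pres_model (gens I) (quadratic_rels I) G f \<longleftrightarrow>
    (\<forall>i\<in>I. f (T i) \<otimes> f (T i) = \<one>) \<and> (\<forall>j\<in>{1..4}. f (S j) \<otimes> f (S j) = \<one>)"
proof -
  interpret group G by fact
  have [simp]: "\<And>i. i \<in> I \<Longrightarrow> f (T i) \<in> carrier G" "\<And>j. j \<in> {1..4} \<Longrightarrow> f (S j) \<in> carrier G"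
    using assms(2) by (auto simp: gens_funcset)
  show ?thesis
    unfolding pres_model_def quadratic_rels_def ball_Un ball_rels
    using assms by auto
qed

section \<open>Restriction and unique extension of models\<close>

lemma pres_model_G'_D4_restrict:
  assumes "pres_model (gens UNIV) G'_D4_rels G f"
  shows "pres_model (gens {0, 1}) Art_D4_rels G f"
proof -
  interpret D4_family G "f \<circ> S" using assms by (simp add: pres_model_G'_D4_iff)
  note f = assms[unfolded pres_model_G'_D4_iff]
  \<comment> \<open>(P3) comes from the braid relation of \<open>T 2\<close>, tied to
    \<open>T 0\<close> and \<open>T 1\<close> by the shift relation for the indices 2 and 1.\<close>
  have x: "f (T 2) \<otimes>\<^bsub>G\<^esub> f (T 1) = f (T 1) \<otimes>\<^bsub>G\<^esub> f (T 0)"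
    using f[THEN conjunct2, THEN conjunct2, THEN conjunct2, rule_format, of 2 1] by simp
  show ?thesis
    unfolding pres_model_Art_D4_iff
  proof (intro conjI ballI)
    fix j :: nat assume "j \<in> {1..4}"
    then show "f (S j) \<otimes>\<^bsub>G\<^esub> (f (T 1) \<otimes>\<^bsub>G\<^esub> f (T 0)) \<otimes>\<^bsub>G\<^esub> f (S j) \<otimes>\<^bsub>G\<^esub> (f (T 1) \<otimes>\<^bsub>G\<^esub> f (T 0)) =
        f (T 1) \<otimes>\<^bsub>G\<^esub> f (T 0) \<otimes>\<^bsub>G\<^esub> f (S j) \<otimes>\<^bsub>G\<^esub> (f (T 1) \<otimes>\<^bsub>G\<^esub> f (T 0)) \<otimes>\<^bsub>G\<^esub> f (S j)"
      using f s_closed[of j] by (intro braid_next_iff[OF _ _ _ _ x, THEN iffD1]) auto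
  qed (use f in auto)
qed

text \<open>The sequence is built from the images of \<open>T 0\<close> and \<open>T 1\<close>; (P3)
  carries the braid relations to all indices.\<close>

lemma pres_model_G'_D4_extend:
  assumes "pres_model (gens {0, 1}) Art_D4_rels G f"
  obtains g where "pres_model (gens UNIV) G'_D4_rels G g" "\<And>x. x \<in> gens {0, 1} \<Longrightarrow> g x = f x"
proof -
  note f = assms[unfolded pres_model_Art_D4_iff]
  interpret D4_family G "f \<circ> S" using f by simp
  obtain t :: "int \<Rightarrow> _" where t: "\<And>i. t i \<in> carrier G" "t 0 = f (T 0)" "t 1 = f (T 1)"
    and shift: "\<And>i. t i \<otimes>\<^bsub>G\<^esub> t (i - 1) = f (T 1) \<otimes>\<^bsub>G\<^esub> f (T 0)"
    using shift_seq_exists[of "f (T 0)" "f (T 1)"] f by blast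
  define g where "g = case_gen t (f \<circ> S)"
  have "t i \<otimes>\<^bsub>G\<^esub> f (S j) \<otimes>\<^bsub>G\<^esub> t i = f (S j) \<otimes>\<^bsub>G\<^esub> t i \<otimes>\<^bsub>G\<^esub> f (S j)" if "j \<in> {1..4}" for i j
    by (rule shift_seq_braid[where t = t, OF t(1) _ shift])
      (use f that s_closed[of j] in \<open>auto simp: t\<close>)
  moreover have "g \<circ> S = f \<circ> S" by (auto simp: g_def)
  ultimately have "pres_model (gens UNIV) G'_D4_rels G g"
    unfolding pres_model_G'_D4_iff using f by (simp add: g_def t shift)
  then show thesis
    by (rule that) (auto simp: g_def gens_def t)
qed

lemma pres_model_G'_D4_unique:
  assumes f: "pres_model (gens UNIV) G'_D4_rels G f" and g: "pres_model (gens UNIV) G'_D4_rels G g"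
    and eq: "\<And>x. x \<in> gens {0, 1} \<Longrightarrow> f x = g x" and "y \<in> gens UNIV"
  shows "f y = g y"
proof -
  interpret D4_family G "f \<circ> S" using f by (simp add: pres_model_G'_D4_iff)
  have eqs: "f (T 0) = g (T 0)" "f (T 1) = g (T 1)" "\<And>j. j \<in> {1..4} \<Longrightarrow> f (S j) = g (S j)"
    using eq by (auto simp: gens_def)
  \<comment> \<open>All consecutive products equal the one at index 1, which involves only
    generators where \<open>f\<close> and \<open>g\<close> agree.\<close>
  have c: "f (T i) \<otimes>\<^bsub>G\<^esub> f (T (i - 1)) = f (T 1) \<otimes>\<^bsub>G\<^esub> f (T 0)"
    "g (T i) \<otimes>\<^bsub>G\<^esub> g (T (i - 1)) = g (T 1) \<otimes>\<^bsub>G\<^esub> g (T 0)" for i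
    using f g by (metis pres_model_G'_D4_iff diff_self)+
  have "f (T i) = g (T i)" for i
    by (rule shift_seq_unique[of "f \<circ> T" "g \<circ> T", unfolded comp_def])
      (use f g in \<open>auto simp: pres_model_G'_D4_iff c eqs\<close>)
  then show ?thesis using \<open>y \<in> gens UNIV\<close> eqs by (auto simp: gens_def)
qed

text \<open>The shift relations propagate the two given quadratic relations for \<open>T 0\<close>
  and \<open>T 1\<close> to every \<open>T i\<close>.\<close>

lemma pres_model_quadratic_extend:
  assumes f: "pres_model (gens UNIV) G'_D4_rels G f"
    and q: "pres_model (gens {0, 1}) (quadratic_rels {0, 1}) G f"
  shows "pres_model (gens UNIV) (quadratic_rels UNIV) G f"
proof -
  interpret D4_family G "f \<circ> S" using f by (simp add: pres_model_G'_D4_iff)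
  have closed: "f \<in> gens UNIV \<rightarrow> carrier G" "f \<in> gens {0, 1} \<rightarrow> carrier G"
    using f q by (simp_all add: pres_model_def)
  have c: "f (T i) \<otimes>\<^bsub>G\<^esub> f (T (i - 1)) = f (T 1) \<otimes>\<^bsub>G\<^esub> f (T 0)" for i
    using f by (metis pres_model_G'_D4_iff diff_self)
  have "f (T i) \<otimes>\<^bsub>G\<^esub> f (T i) = \<one>\<^bsub>G\<^esub>" for i
    by (rule shift_seq_involution[where t = "\<lambda>i. f (T i)", OF _ c])
      (use q closed in \<open>auto simp: pres_model_quadratic_iff gens_funcset\<close>)
  then show ?thesis
    using q closed by (simp add: pres_model_quadratic_iff)
qed

section \<open>The isomorphisms for the Artin group and its quadratic quotient\<close>

theorem proposition3p2:
  shows "Art_D4 \<cong> G'_D4 \<and>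
    Hyp_D4 \<cong> presented_group (gens UNIV) (G'_D4_rels \<union> quadratic_rels UNIV)"
proof
  show "Art_D4 \<cong> G'_D4"
    unfolding Art_D4_def G'_D4_def
  proof (rule presented_group_iso)
    show "\<exists>g. pres_model (gens UNIV) G'_D4_rels G g \<and> (\<forall>x\<in>gens {0, 1}. g x = f x)"
      if "pres_model (gens {0, 1}) Art_D4_rels G f" for G :: "gen word set monoid" and f
      by (rule pres_model_G'_D4_extend[OF that]) auto
    show "f y = g y"
      if "pres_model (gens UNIV) G'_D4_rels G f" "pres_model (gens UNIV) G'_D4_rels G g"
        "\<And>x. x \<in> gens {0, 1} \<Longrightarrow> f x = g x" "y \<in> gens UNIV"
      for G :: "gen word set monoid" and f g y
      using that by (rule pres_model_G'_D4_unique)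
  qed (use rels_words gens_mono in \<open>simp_all add: pres_model_G'_D4_restrict\<close>)
next
  show "Hyp_D4 \<cong> presented_group (gens UNIV) (G'_D4_rels \<union> quadratic_rels UNIV)"
    unfolding Hyp_D4_def
  proof (rule presented_group_iso)
    fix G :: "gen word set monoid" and f
    assume "pres_model (gens UNIV) (G'_D4_rels \<union> quadratic_rels UNIV) G f"
    then have f: "pres_model (gens UNIV) G'_D4_rels G f"
      and q: "pres_model (gens UNIV) (quadratic_rels UNIV) G f"
      by (simp_all add: pres_model_Un)
    have "pres_model (gens {0, 1}) (quadratic_rels {0, 1}) G f"
      by (rule pres_model_mono[OF q gens_mono quadratic_rels_mono]) simp_all
    with pres_model_G'_D4_restrict[OF f]
    show "pres_model (gens {0, 1}) (Art_D4_rels \<union> quadratic_rels {0, 1}) G f"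
      by (simp add: pres_model_Un)
  next
    fix G :: "gen word set monoid" and f
    assume "pres_model (gens {0, 1}) (Art_D4_rels \<union> quadratic_rels {0, 1}) G f"
    then have f: "pres_model (gens {0, 1}) Art_D4_rels G f"
      and q: "pres_model (gens {0, 1}) (quadratic_rels {0, 1}) G f"
      by (simp_all add: pres_model_Un)
    obtain g where g: "pres_model (gens UNIV) G'_D4_rels G g" "\<And>x. x \<in> gens {0, 1} \<Longrightarrow> g x = f x"
      using pres_model_G'_D4_extend[OF f] by blast
    \<comment> \<open>\<open>g\<close> is chosen without regard to squares; the quadratic relations
      pass to it from \<open>f\<close> because they agree on the finite generators.\<close>
    have "pres_model (gens {0, 1}) (quadratic_rels {0, 1}) G g"
      by (rule pres_model_cong[OF rels_words(3) g(2), THEN iffD2, OF _ q])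
    with g show "\<exists>g. pres_model (gens UNIV) (G'_D4_rels \<union> quadratic_rels UNIV) G g \<and>
        (\<forall>x\<in>gens {0, 1}. g x = f x)"
      using pres_model_quadratic_extend[OF g(1)] by (auto simp: pres_model_Un)
  next
    fix G :: "gen word set monoid" and f g y
    assume "pres_model (gens UNIV) (G'_D4_rels \<union> quadratic_rels UNIV) G f"
      and "pres_model (gens UNIV) (G'_D4_rels \<union> quadratic_rels UNIV) G g"
      and "\<And>x. x \<in> gens {0, 1} \<Longrightarrow> f x = g x" and "y \<in> gens UNIV"
    then show "f y = g y"
      by (intro pres_model_G'_D4_unique[of G f g y]) (simp_all add: pres_model_Un)
  qed (use rels_words gens_mono in \<open>simp_all add: le_supI\<close>)
qed

end
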